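(* Let $V_{R_0}\colon\mathbb R^d\times\mathbb R^d\to\mathbb R$ be such that for all $F\in\mathcal M^d\cup\{\delta_y : y\in\mathbb R^d\}$ and $k\in\mathbb R^d$ one has $\bar V_{R_0}(k,F)\in(-\infty,0]$ if $k\notin R(F)$ and $\bar V_{R_0}(k,F)\in[0,\infty)$ if $k\in R(F)$. Suppose $R(Y)\in\widehat{\mathcal P}(\mathbb R^d;\mathbb R^d_+)$ for all $Y\in\mathcal Y^d$, let $\pi$ be a $\sigma$-finite non-negative measure on $\mathcal B(\mathbb R^d)$, and let $$S_{R,\pi}(A,y)=\int_{\mathbb R^d}\big(\mathbf 1_{R(y)\setminus A}(k)-\mathbf 1_{A\setminus R(y)}(k)\big)V_{R_0}(k,y)\,\pi(dk),\quad A\in\widehat{\mathcal P}(\mathbb R^d;\mathbb R^d_+),\ y\in\mathbb R^d.$$ Then $S_{R,\pi}$ is $\mathcal M^d$-order-sensitive for $R$ in the sense that for all $A,B\in\widehat{\mathcal P}(\mathbb R^d;\mathbb R^d_+)$ and all $F\in\mathcal M^d$ $$\big(A\subseteq B\subseteq R(F)\ \text{ or }\ A\supseteq B\supseteq R(F)\big)\implies\bar S_{R,\pi}(A,F)\ge\bar S_{R,\pi}(B,F).$$ Suppose in addition that for all $Y\in\mathcal Y^d$, $R(Y)\in\mathcal F(\mathbb R^d;\mathbb R^d_+)$ and $R_0(Y)=\partial R(Y)$ (topological boundary), that $V_{R_0}$ is a strict selective $\mathcal M^d$-identification function for $R_0$, and that $\pi$ is strictly positive. Let $A,B\in\mathcal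 F(\mathbb R^d;\mathbb R^d_+)$ and $F\in\mathcal M^d$ satisfy $A\subseteq B\subseteq R(F)$ or $A\supseteq B\supseteq R(F)$. If $\bar S_{R,\pi}(B,F)<\infty$ and the inclusion $A\subseteq B$ (respectively $A\supseteq B$) is strict, then $\bar S_{R,\pi}(A,F)>\bar S_{R,\pi}(B,F)$.
   Context: Setting: $(\Omega,\mathfrak F,\mathbb P)$ is an atomless probability space, $d\ge1$, $\mathcal Y^d\subseteq L^0(\Omega;\mathbb R^d)$ is a class of random vectors closed under translation by constants $k\in\mathbb R^d$. $\Lambda\colon\mathbb R^d\to\mathbb R$ is an aggregation function, i.e. non-decreasing for the componentwise order. $\mathcal Y\subseteq L^0(\Omega;\mathbb R)$ contains $\Lambda(Y)$ for all $Y\in\mathcal Y^d$ and is closed under translation by constants. $\mathcal M^d$ and $\mathcal M$ are the classes of distributions of elements of $\mathcal Y^d$ and $\mathcal Y$. $\rho\colon\mathcal Y\to\mathbb R$ is a law-invariant scalar risk measure that is cash-invariant ($\rho(X+m)=\rho(X)-m$) and monotone ($X\ge Z$ a.s. implies $\rho(X)\le\rho(Z)$). Define $R(Y)=\{k\in\mathbb R^d:\rho(\Lambda(Y+k))\le0\}$ and $R_0(Y)=\{k\in\mathbb R^d:\rho(\Lambda(Y+k))=0\}$; these are law-invariant and we write $R(F_Y)=R(Y)$, $R_0(F_Y)=R_0(Y)$. For $y\in\mathbb R^d$, $\delta_y$ is the point mass at $y$ and $R(y):=R(\delta_y)=\{k:\rho(\Lambda(y+k))\le0\}$, where $\rho$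 is understood to be defined (with the same properties) on constants as well. $\widehat{\mathcal P}(\mathbb R^d;\mathbb R^d_+)$ is the class of Borel sets $B\subseteq\mathbb R^d$ with $B=B+\mathbb R^d_+$ (upper sets; $\emptyset$ is allowed) and $B\neq\mathbb R^d$. $\mathcal F(\mathbb R^d;\mathbb R^d_+)\subset\widehat{\mathcal P}(\mathbb R^d;\mathbb R^d_+)$ is the subclass of closed upper sets. A measure on $\mathcal B(\mathbb R^d)$ is strictly positive if it gives positive mass to every non-empty open set. Write $\bar V(k,F)=\int V(k,y)\,dF(y)$ and $\bar S(A,F)=\int S(A,y)\,dF(y)$; all integrals are tacitly assumed well defined (in particular $V_{R_0}$ and the integrands are jointly measurable). $V$ is a strict selective $\mathcal M^d$-identification function for $R_0$ if $\bar V(k,F)=0\iff k\in R_0(F)$ for all $k\in\mathbb R^d$, $F\in\mathcal M^d$. *)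

theory Defs
  imports "HOL-Probability.Probability"
begin

text \<open>Integral with values in the extended reals. The convention \<open>\<infinity> - \<infinity> = \<infinity>\<close> of type \<open>ereal\<close>
  means that a finite value forces both parts to be finite, so that for measurable
  real-valued \<open>f\<close> a finite value is the Lebesgue integral of an integrable function.\<close>

definition ext_integral :: "'a measure \<Rightarrow> ('a \<Rightarrow> ereal) \<Rightarrow> ereal" where
  "ext_integral M f =
     enn2ereal (\<integral>\<^sup>+ x. e2ennreal (f x) \<partial>M) - enn2ereal (\<integral>\<^sup>+ x. e2ennreal (- f x) \<partial>M)"

lemma ext_integral_eq_lebesgue:
  fixes f :: "'a \<Rightarrow> real"
  assumes "integrable M f"
  shows "ext_integral M (\<lambda>x. ereal (f x)) = ereal (\<integral>x. f x \<partial>M)"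
proof -
  obtain r q where rq: "0 \<le> r" "0 \<le> q" "(\<integral>\<^sup>+x. ennreal (f x) \<partial>M) = ennreal r"
    "(\<integral>\<^sup>+x. ennreal (- f x) \<partial>M) = ennreal q" "(\<integral>x. f x \<partial>M) = r - q"
    using integrableE[OF assms] by metis
  have "\<And>x. e2ennreal (ereal (f x)) = ennreal (f x)" "\<And>x. e2ennreal (- ereal (f x)) = ennreal (- f x)"
    by (simp_all add: e2ennreal_ereal)
  then show ?thesis
    using rq by (simp add: ext_integral_def enn2ereal_ennreal del: uminus_ereal.simps)
qed

definition atomless :: "'w measure \<Rightarrow> bool" where
  "atomless M \<longleftrightarrow> (\<forall>A\<in>sets M. 0 < emeasure M A \<longrightarrow>
     (\<exists>B\<in>sets M. B \<subseteq> A \<and> 0 < emeasure M B \<and> emeasure M B < emeasure M A))"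

definition constants :: "('w \<Rightarrow> 'b) set" where
  "constants = range (\<lambda>y _. y)"

definition laws :: "'w measure \<Rightarrow> ('w \<Rightarrow> 'b::topological_space) set \<Rightarrow> 'b measure set" where
  "laws M Z = distr M borel ` Z"

definition law_invariant_on ::
  "'w measure \<Rightarrow> ('w \<Rightarrow> 'b::topological_space) set \<Rightarrow> (('w \<Rightarrow> 'b) \<Rightarrow> 'c) \<Rightarrow> bool" where
  "law_invariant_on M Z T \<longleftrightarrow>
     (\<forall>X\<in>Z. \<forall>X'\<in>Z. distr M borel X = distr M borel X' \<longrightarrow> T X = T X')"

text \<open>The functional on laws induced by a law-invariant functional on random variables.\<close>

definition on_law ::
  "'w measure \<Rightarrow> ('w \<Rightarrow> 'b::topological_space) set \<Rightarrow> (('w \<Rightarrow> 'b) \<Rightarrow> 'c) \<Rightarrow> 'b measure \<Rightarrow> 'c" where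
  "on_law M Z T F = T (SOME X. X \<in> Z \<and> distr M borel X = F)"

lemma on_law_distr:
  assumes "law_invariant_on M Z T" "X \<in> Z"
  shows "on_law M Z T (distr M borel X) = T X"
proof -
  let ?X = "SOME X'. X' \<in> Z \<and> distr M borel X' = distr M borel X"
  have "?X \<in> Z \<and> distr M borel ?X = distr M borel X"
    using assms(2) by (intro someI[where P = "\<lambda>X'. X' \<in> Z \<and> distr M borel X' = distr M borel X"]) blast
  then show ?thesis
    using assms unfolding on_law_def law_invariant_on_def by blast
qed

text \<open>Random variables are represented by measurable functions rather than by classes modulo
  almost sure equality; law invariance of \<open>\<rho>\<close> makes the choice of representatives irrelevant.
  The risk measure \<open>\<rho>\<close> is given on \<open>\<Y>\<close> together with the constants.\<close>

locale systemic_risk = prob_space M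
  for M :: "'w measure"
    and \<Y>d :: "('w \<Rightarrow> real ^ 'n) set"
    and \<Y> :: "('w \<Rightarrow> real) set"
    and \<Lambda> :: "real ^ 'n \<Rightarrow> real"
    and \<rho> :: "('w \<Rightarrow> real) \<Rightarrow> real" +
  assumes atomless: "atomless M"
    and \<Y>d_measurable: "\<Y>d \<subseteq> borel_measurable M"
    and \<Y>d_translate: "Y \<in> \<Y>d \<Longrightarrow> (\<lambda>\<omega>. Y \<omega> + k) \<in> \<Y>d"
    and \<Lambda>_mono: "mono \<Lambda>"
    and \<Y>_measurable: "\<Y> \<subseteq> borel_measurable M"
    and \<Lambda>_in_\<Y>: "Y \<in> \<Y>d \<Longrightarrow> (\<lambda>\<omega>. \<Lambda> (Y \<omega>)) \<in> \<Y>"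
    and \<Y>_translate: "X \<in> \<Y> \<Longrightarrow> (\<lambda>\<omega>. X \<omega> + m) \<in> \<Y>"
    and \<rho>_law_invariant: "law_invariant_on M (\<Y> \<union> constants) \<rho>"
    and \<rho>_cash_invariant: "X \<in> \<Y> \<union> constants \<Longrightarrow> \<rho> (\<lambda>\<omega>. X \<omega> + m) = \<rho> X - m"
    and \<rho>_monotone: "X \<in> \<Y> \<union> constants \<Longrightarrow> Z \<in> \<Y> \<union> constants \<Longrightarrow>
          (AE \<omega> in M. Z \<omega> \<le> X \<omega>) \<Longrightarrow> \<rho> X \<le> \<rho> Z"

definition R :: "(real ^ 'n \<Rightarrow> real) \<Rightarrow> (('w \<Rightarrow> real) \<Rightarrow> real) \<Rightarrow> ('w \<Rightarrow> real ^ 'n) \<Rightarrow> (real ^ 'n) set" where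
  "R \<Lambda> \<rho> Y = {k. \<rho> (\<lambda>\<omega>. \<Lambda> (Y \<omega> + k)) \<le> 0}"

definition R0 :: "(real ^ 'n \<Rightarrow> real) \<Rightarrow> (('w \<Rightarrow> real) \<Rightarrow> real) \<Rightarrow> ('w \<Rightarrow> real ^ 'n) \<Rightarrow> (real ^ 'n) set" where
  "R0 \<Lambda> \<rho> Y = {k. \<rho> (\<lambda>\<omega>. \<Lambda> (Y \<omega> + k)) = 0}"

definition R_point :: "(real ^ 'n \<Rightarrow> real) \<Rightarrow> (('w \<Rightarrow> real) \<Rightarrow> real) \<Rightarrow> real ^ 'n \<Rightarrow> (real ^ 'n) set" where
  "R_point \<Lambda> \<rho> y = R \<Lambda> \<rho> (\<lambda>_. y)"

text \<open>\<open>R\<close> and \<open>R0\<close> as functions of a law, defined for the laws of elements of \<open>\<Y>d\<close> and for the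
  point masses \<open>return borel y\<close>, which are the laws of the constants.\<close>

definition R_law ::
  "'w measure \<Rightarrow> ('w \<Rightarrow> real ^ 'n) set \<Rightarrow> (real ^ 'n \<Rightarrow> real) \<Rightarrow> (('w \<Rightarrow> real) \<Rightarrow> real) \<Rightarrow>
    (real ^ 'n) measure \<Rightarrow> (real ^ 'n) set" where
  "R_law M \<Y>d \<Lambda> \<rho> = on_law M (\<Y>d \<union> constants) (R \<Lambda> \<rho>)"

definition R0_law ::
  "'w measure \<Rightarrow> ('w \<Rightarrow> real ^ 'n) set \<Rightarrow> (real ^ 'n \<Rightarrow> real) \<Rightarrow> (('w \<Rightarrow> real) \<Rightarrow> real) \<Rightarrow>
    (real ^ 'n) measure \<Rightarrow> (real ^ 'n) set" where
  "R0_law M \<Y>d \<Lambda> \<rho> = on_law M (\<Y>d \<union> constants) (R0 \<Lambda> \<rho>)"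

context systemic_risk
begin

lemma agg_in_domain:
  assumes "Y \<in> \<Y>d \<union> constants"
  shows "(\<lambda>\<omega>. \<Lambda> (Y \<omega> + k)) \<in> \<Y> \<union> constants"
  using assms \<Lambda>_in_\<Y>[OF \<Y>d_translate[of Y k]] by (auto simp: constants_def)

text \<open>For Borel measurable \<open>\<Lambda>\<close> the law of \<open>\<Lambda>(Y + k)\<close> is determined by that of \<open>Y\<close>, so \<open>R\<close> and
  \<open>R0\<close> are law-invariant. A monotone \<open>\<Lambda>\<close> need not be Borel in dimension at least two.\<close>

lemma \<rho>_agg_eq:
  assumes "\<Lambda> \<in> borel_measurable borel" "Y \<in> \<Y>d \<union> constants" "Y' \<in> \<Y>d \<union> constants"
    and "distr M borel Y = distr M borel Y'"
  shows "\<rho> (\<lambda>\<omega>. \<Lambda> (Y \<omega> + k)) = \<rho> (\<lambda>\<omega>. \<Lambda> (Y' \<omega> + k))"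
proof -
  have g: "(\<lambda>x. \<Lambda> (x + k)) \<in> borel_measurable borel"
    using assms(1) by measurable
  have m: "Y \<in> borel_measurable M" "Y' \<in> borel_measurable M"
    using assms(2,3) \<Y>d_measurable by (auto simp: constants_def)
  have "distr M borel (\<lambda>\<omega>. \<Lambda> (Y \<omega> + k)) = distr M borel (\<lambda>\<omega>. \<Lambda> (Y' \<omega> + k))"
    using distr_distr[OF g m(1)] distr_distr[OF g m(2)] assms(4) by (simp add: comp_def)
  then show ?thesis
    using \<rho>_law_invariant agg_in_domain[OF assms(2)] agg_in_domain[OF assms(3)]
    unfolding law_invariant_on_def by blast
qed

lemma R_law_distr:
  assumes "\<Lambda> \<in> borel_measurable borel" "Y \<in> \<Y>d \<union> constants"
  shows "R_law M \<Y>d \<Lambda> \<rho> (distr M borel Y) = R \<Lambda> \<rho> Y"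
    and "R0_law M \<Y>d \<Lambda> \<rho> (distr M borel Y) = R0 \<Lambda> \<rho> Y"
proof -
  have "R \<Lambda> \<rho> X = R \<Lambda> \<rho> X'" "R0 \<Lambda> \<rho> X = R0 \<Lambda> \<rho> X'"
    if "X \<in> \<Y>d \<union> constants" "X' \<in> \<Y>d \<union> constants" "distr M borel X = distr M borel X'"
    for X X'
    unfolding R_def R0_def by (simp_all only: \<rho>_agg_eq[OF assms(1) that])
  then have "law_invariant_on M (\<Y>d \<union> constants) (R \<Lambda> \<rho>)"
    and "law_invariant_on M (\<Y>d \<union> constants) (R0 \<Lambda> \<rho>)"
    unfolding law_invariant_on_def by blast+
  then show "R_law M \<Y>d \<Lambda> \<rho> (distr M borel Y) = R \<Lambda> \<rho> Y"
    and "R0_law M \<Y>d \<Lambda> \<rho> (distr M borel Y) = R0 \<Lambda> \<rho> Y"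
    using assms(2) by (simp_all add: R_law_def R0_law_def on_law_distr)
qed

text \<open>At point masses this holds for every monotone \<open>\<Lambda>\<close>.\<close>

lemma R_law_return: "R_law M \<Y>d \<Lambda> \<rho> (return borel y) = R_point \<Lambda> \<rho> y"
proof -
  let ?P = "\<lambda>Y :: 'w \<Rightarrow> real ^ 'n. Y \<in> \<Y>d \<union> constants \<and> distr M borel Y = return borel y"
  define Y where "Y = (SOME Y. ?P Y)"
  have c: "(\<lambda>_ :: 'w. y) \<in> constants" by (simp add: constants_def)
  have "?P (\<lambda>_. y)"
    using c distr_const[of y borel] by simp
  then have Y: "Y \<in> \<Y>d \<union> constants" "distr M borel Y = return borel y"
    unfolding Y_def using someI[of ?P "\<lambda>_. y"] by blast+
  have mY: "Y \<in> borel_measurable M"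
    using Y(1) \<Y>d_measurable by (auto simp: constants_def)
  have "AE x in distr M borel Y. x = y"
    unfolding Y(2) by (subst AE_return) auto
  then have ae: "AE \<omega> in M. Y \<omega> = y"
    by (subst (asm) AE_distr_iff[OF mY]) auto
  have "\<rho> (\<lambda>\<omega>. \<Lambda> (Y \<omega> + k)) = \<rho> (\<lambda>_. \<Lambda> (y + k))" for k
  proof (rule antisym; rule \<rho>_monotone)
    show "AE \<omega> in M. \<Lambda> (y + k) \<le> \<Lambda> (Y \<omega> + k)" "AE \<omega> in M. \<Lambda> (Y \<omega> + k) \<le> \<Lambda> (y + k)"
      by (use ae in eventually_elim, simp)+
  qed (use agg_in_domain[OF Y(1), of k] agg_in_domain[of "\<lambda>_. y" k] c in simp_all)
  then show ?thesis
    unfolding R_law_def on_law_def R_point_def R_def Y_def by simp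
qed

end

definition upper_sets :: "(real ^ 'n) set set" where
  "upper_sets = {B \<in> sets borel. B = {b + c | b c. b \<in> B \<and> 0 \<le> c} \<and> B \<noteq> UNIV}"

definition closed_upper_sets :: "(real ^ 'n) set set" where
  "closed_upper_sets = {B \<in> upper_sets. closed B}"

definition strictly_positive :: "'b::topological_space measure \<Rightarrow> bool" where
  "strictly_positive \<pi> \<longleftrightarrow> (\<forall>U. open U \<longrightarrow> U \<noteq> {} \<longrightarrow> 0 < emeasure \<pi> U)"

definition expected_ident :: "('k \<Rightarrow> 'b \<Rightarrow> real) \<Rightarrow> 'k \<Rightarrow> 'b measure \<Rightarrow> ereal" where
  "expected_ident V k F = ext_integral F (\<lambda>y. ereal (V k y))"

definition expected_score :: "('a \<Rightarrow> 'b \<Rightarrow> ereal) \<Rightarrow> 'a \<Rightarrow> 'b measure \<Rightarrow> ereal" where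
  "expected_score S A F = ext_integral F (S A)"

definition strict_selective_identification ::
  "'b measure set \<Rightarrow> ('b measure \<Rightarrow> 'k set) \<Rightarrow> ('k \<Rightarrow> 'b \<Rightarrow> real) \<Rightarrow> bool" where
  "strict_selective_identification \<M> T V \<longleftrightarrow>
     (\<forall>k. \<forall>F\<in>\<M>. expected_ident V k F = 0 \<longleftrightarrow> k \<in> T F)"

definition score_integrand ::
  "(real ^ 'n \<Rightarrow> real) \<Rightarrow> (('w \<Rightarrow> real) \<Rightarrow> real) \<Rightarrow> (real ^ 'n \<Rightarrow> real ^ 'n \<Rightarrow> real) \<Rightarrow>
    (real ^ 'n) set \<Rightarrow> real ^ 'n \<Rightarrow> real ^ 'n \<Rightarrow> real" where
  "score_integrand \<Lambda> \<rho> V A k y =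
     (indicator (R_point \<Lambda> \<rho> y - A) k - indicator (A - R_point \<Lambda> \<rho> y) k) * V k y"

definition score ::
  "(real ^ 'n \<Rightarrow> real) \<Rightarrow> (('w \<Rightarrow> real) \<Rightarrow> real) \<Rightarrow> (real ^ 'n \<Rightarrow> real ^ 'n \<Rightarrow> real) \<Rightarrow>
    (real ^ 'n) measure \<Rightarrow> (real ^ 'n) set \<Rightarrow> real ^ 'n \<Rightarrow> ereal" where
  "score \<Lambda> \<rho> V \<pi> A y = ext_integral \<pi> (\<lambda>k. ereal (score_integrand \<Lambda> \<rho> V A k y))"

definition order_sensitive ::
  "'a set set \<Rightarrow> 'b measure set \<Rightarrow> ('b measure \<Rightarrow> 'a set) \<Rightarrow> ('a set \<Rightarrow> 'b \<Rightarrow> ereal) \<Rightarrow> bool" where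
  "order_sensitive \<A> \<M> T S \<longleftrightarrow>
     (\<forall>A\<in>\<A>. \<forall>B\<in>\<A>. \<forall>F\<in>\<M>.
        (A \<subseteq> B \<and> B \<subseteq> T F) \<or> (T F \<subseteq> B \<and> B \<subseteq> A) \<longrightarrow>
        expected_score S B F \<le> expected_score S A F)"

end

theory Submission
  imports Defs
begin

text \<open>Orientation at the point masses says that \<open>V(k,y)\<close> is non-negative for
  \<open>k \<in> R(y)\<close> and non-positive otherwise, so the integrand equals \<open>(1\<^bsub>R(y)\<^esub>(k) - 1\<^bsub>A\<^esub>(k)) V(k,y) \<ge> 0\<close> and Tonelli
  gives the expected score of \<open>A\<close> as the \<open>\<pi>\<close>-integral of \<open>k \<mapsto> \<integral> (1\<^bsub>R(y)\<^esub>(k) - 1\<^bsub>A\<^esub>(k)) V(k,y) dF(y)\<close>.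
  For \<open>k\<close> in \<open>A\<close> this inner integral is that of the negative part of \<open>V(k,\<cdot>)\<close>, otherwise that of the
  positive part. Two scores therefore differ only over the symmetric difference of the two sets,
  where the difference of the inner integrals is the expectation of \<open>V(k,\<cdot>)\<close> up to sign, and
  orientation at \<open>F\<close> fixes that sign. For closed upper sets, the difference of two strictly nested
  ones contains a non-empty open set, which misses the boundary of \<open>R(F)\<close>; there the expectation
  of \<open>V(k,\<cdot>)\<close> does not vanish, and \<open>\<pi>\<close> charges this open set.\<close>

section \<open>Integrals in the extended reals and their signs\<close>

lemma ext_integral_ereal:
  "ext_integral M (\<lambda>x. ereal (f x)) =
     enn2ereal (\<integral>\<^sup>+ x. ennreal (f x) \<partial>M) - enn2ereal (\<integral>\<^sup>+ x. ennreal (- f x) \<partial>M)"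
  by (simp add: ext_integral_def e2ennreal_ereal)

lemma ext_integral_nonneg:
  assumes "\<And>x. 0 \<le> f x"
  shows "ext_integral M f = enn2ereal (\<integral>\<^sup>+ x. e2ennreal (f x) \<partial>M)"
proof -
  have "e2ennreal (- f x) = 0" for x
    using assms[of x] by (intro e2ennreal_neg) (simp add: ereal_uminus_le_0_iff)
  then show ?thesis
    by (simp add: ext_integral_def zero_ennreal.rep_eq)
qed

text \<open>Turns the orientation hypothesis at point masses into a sign of \<open>V k y\<close>
  itself. One of the two parts vanishes, so the subtraction is harmless.\<close>

lemma expected_ident_return:
  assumes "V k \<in> borel_measurable borel"
  shows "expected_ident V k (return borel y) = ereal (V k y)"
proof -
  have "(\<integral>\<^sup>+ x. ennreal (V k x) \<partial>return borel y) = ennreal (V k y)"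
    "(\<integral>\<^sup>+ x. ennreal (- V k x) \<partial>return borel y) = ennreal (- V k y)"
    using assms by (simp_all add: nn_integral_return)
  then show ?thesis
    by (cases "0 \<le> V k y") (simp_all add: expected_ident_def ext_integral_ereal enn2ereal_ennreal ennreal_neg
        zero_ennreal.rep_eq)
qed

text \<open>With the convention \<infinity> - \<infinity> = \<infinity>, the upper bound forces
  \<open>p\<close> to be finite; then \<open>q\<close> is finite as well, for otherwise the
  difference would be -\<infinity>.\<close>

lemma enn2ereal_diff_pos_finite:
  assumes "0 \<le> enn2ereal p - enn2ereal q" "enn2ereal p - enn2ereal q < \<infinity>"
  shows "q \<le> p" and "enn2ereal p - enn2ereal q \<noteq> 0 \<Longrightarrow> q < p"
  using assms by (cases p; cases q; simp add: enn2ereal_ennreal ennreal_less_iff)+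

lemma enn2ereal_diff_neg_finite:
  assumes "enn2ereal p - enn2ereal q \<le> 0" "- \<infinity> < enn2ereal p - enn2ereal q"
  shows "p \<le> q" and "enn2ereal p - enn2ereal q \<noteq> 0 \<Longrightarrow> p < q"
  using assms by (cases p; cases q; simp add: enn2ereal_ennreal ennreal_less_iff)+

text \<open>Restates the sign of the expectation as a comparison of its positive and negative parts,
  the two values that the inner integral of the score can take.\<close>

lemma expected_ident_nonneg_imp:
  assumes "expected_ident V k F \<in> {0..<\<infinity>}"
  shows "(\<integral>\<^sup>+ y. ennreal (- V k y) \<partial>F) \<le> (\<integral>\<^sup>+ y. ennreal (V k y) \<partial>F)"
    and "expected_ident V k F \<noteq> 0 \<Longrightarrow>
      (\<integral>\<^sup>+ y. ennreal (- V k y) \<partial>F) < (\<integral>\<^sup>+ y. ennreal (V k y) \<partial>F)"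
  using assms enn2ereal_diff_pos_finite unfolding expected_ident_def ext_integral_ereal by auto

lemma expected_ident_nonpos_imp:
  assumes "expected_ident V k F \<in> {-\<infinity><..0}"
  shows "(\<integral>\<^sup>+ y. ennreal (V k y) \<partial>F) \<le> (\<integral>\<^sup>+ y. ennreal (- V k y) \<partial>F)"
    and "expected_ident V k F \<noteq> 0 \<Longrightarrow>
      (\<integral>\<^sup>+ y. ennreal (V k y) \<partial>F) < (\<integral>\<^sup>+ y. ennreal (- V k y) \<partial>F)"
  using assms enn2ereal_diff_neg_finite unfolding expected_ident_def ext_integral_ereal by auto

section \<open>Upper sets and representatives of laws\<close>

lemma upper_set_add:
  assumes "B \<in> upper_sets" "b \<in> B" "0 \<le> c"
  shows "b + c \<in> B"
proof -
  have "B = {b + c | b c. b \<in> B \<and> 0 \<le> c}"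
    using assms(1) by (simp add: upper_sets_def)
  then show ?thesis
    using assms(2,3) by blast
qed

text \<open>The open orthant strictly above a point \<open>b\<close> of \<open>B - A\<close> lies in
  \<open>B\<close>, and removing the closed \<open>A\<close> keeps it open.\<close>

lemma open_subset_upper_diff:
  fixes A B :: "(real ^ 'n) set"
  assumes "closed A" "B \<in> upper_sets" "\<not> B \<subseteq> A"
  obtains U where "open U" "U \<noteq> {}" "U \<subseteq> B - A"
proof -
  obtain b where b: "b \<in> B" "b \<notin> A"
    using assms(3) by blast
  define U where "U = {x. \<forall>i. b $ i < x $ i} - A"
  have "open {x :: real ^ 'n. \<forall>i. b $ i < x $ i}"
    unfolding Collect_all_eq by (intro open_INT ballI open_Collect_less continuous_intros) simp
  then have "open U"
    using assms(1) by (simp add: U_def open_Diff)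
  moreover have "U \<noteq> {}"
  proof -
    \<comment> \<open>Points on the diagonal above \<open>b\<close> lie in the orthant and tend to
      \<open>b\<close>, so they finally enter the open complement of \<open>A\<close>.\<close>
    have "(\<lambda>e :: real. b + e *\<^sub>R 1) \<midarrow>0\<rightarrow> b + 0 *\<^sub>R 1"
      by (intro tendsto_intros)
    then have "((\<lambda>e :: real. b + e *\<^sub>R 1) \<longlongrightarrow> b) (at_right 0)"
      by (simp add: filterlim_at_split)
    then have "\<forall>\<^sub>F e in at_right 0. b + e *\<^sub>R 1 \<in> - A"
      using assms(1) b(2) by (intro topological_tendstoD) auto
    moreover have "\<forall>\<^sub>F e in at_right (0 :: real). 0 < e"
      by (rule eventually_at_right_less)
    ultimately have "\<forall>\<^sub>F e in at_right 0. b + e *\<^sub>R 1 \<in> U"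
      by eventually_elim (simp add: U_def)
    then have "\<exists>e. b + e *\<^sub>R 1 \<in> U"
      by (rule eventually_happens'[rotated]) simp
    then show ?thesis
      by blast
  qed
  moreover have "U \<subseteq> B - A"
  proof
    fix x assume x: "x \<in> U"
    have "0 \<le> x - b"
      using x by (auto simp: U_def less_eq_vec_def intro: less_imp_le)
    then have "b + (x - b) \<in> B"
      by (rule upper_set_add[OF assms(2) b(1)])
    then show "x \<in> B - A"
      using x by (simp add: U_def)
  qed
  ultimately show ?thesis
    using that by blast
qed

text \<open>Since \<open>R_law\<close> chooses a representative in \<open>\<Y>d \<union> constants\<close>, it may pick a constant outside
  \<open>\<Y>d\<close>; monotonicity of \<open>\<rho>\<close> then lets an almost surely equal element of \<open>\<Y>d\<close> take over.\<close>

lemma (in systemic_risk) law_representative: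
  assumes "F \<in> laws M \<Y>d"
  obtains Y where "Y \<in> \<Y>d" "R_law M \<Y>d \<Lambda> \<rho> F = R \<Lambda> \<rho> Y" "R0_law M \<Y>d \<Lambda> \<rho> F = R0 \<Lambda> \<rho> Y"
proof -
  let ?P = "\<lambda>X :: 'w \<Rightarrow> real ^ 'n. X \<in> \<Y>d \<union> constants \<and> distr M borel X = F"
  obtain Y where Y: "Y \<in> \<Y>d" "F = distr M borel Y"
    using assms by (auto simp: laws_def)
  define X where "X = (SOME X. ?P X)"
  have X: "X \<in> \<Y>d \<union> constants" "distr M borel X = F"
    using someI[of ?P Y] Y unfolding X_def by auto
  have law: "R_law M \<Y>d \<Lambda> \<rho> F = R \<Lambda> \<rho> X" "R0_law M \<Y>d \<Lambda> \<rho> F = R0 \<Lambda> \<rho> X"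
    by (simp_all add: R_law_def R0_law_def on_law_def X_def)
  show ?thesis
  proof (cases "X \<in> \<Y>d")
    case True
    then show ?thesis
      using that law by blast
  next
    case False
    then obtain y where y: "X = (\<lambda>_. y)"
      using X(1) by (auto simp: constants_def)
    have eq: "distr M borel Y = return borel y"
      using X(2) Y(2) distr_const[of y borel] by (simp add: y)
    have "AE x in distr M borel Y. x = y"
      unfolding eq by (subst AE_return) auto
    moreover have "Y \<in> borel_measurable M"
      using Y(1) \<Y>d_measurable by blast
    ultimately have ae: "AE \<omega> in M. Y \<omega> = X \<omega>"
      by (simp add: AE_distr_iff y)
    have "\<rho> (\<lambda>\<omega>. \<Lambda> (Y \<omega> + k)) = \<rho> (\<lambda>\<omega>. \<Lambda> (X \<omega> + k))" for k
    proof (rule antisym; rule \<rho>_monotone)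
      show "AE \<omega> in M. \<Lambda> (X \<omega> + k) \<le> \<Lambda> (Y \<omega> + k)" "AE \<omega> in M. \<Lambda> (Y \<omega> + k) \<le> \<Lambda> (X \<omega> + k)"
        by (use ae in eventually_elim, simp)+
    qed (use agg_in_domain[OF X(1), of k] agg_in_domain[of Y k] Y(1) in auto)
    then have "R \<Lambda> \<rho> X = R \<Lambda> \<rho> Y" "R0 \<Lambda> \<rho> X = R0 \<Lambda> \<rho> Y"
      by (simp_all add: R_def R0_def)
    then show ?thesis
      using that Y(1) law by simp
  qed
qed

section \<open>The score as an iterated integral\<close>

definition inner_score ::
  "(real ^ 'n \<Rightarrow> real) \<Rightarrow> (('w \<Rightarrow> real) \<Rightarrow> real) \<Rightarrow> (real ^ 'n \<Rightarrow> real ^ 'n \<Rightarrow> real) \<Rightarrow>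
    (real ^ 'n) measure \<Rightarrow> (real ^ 'n) set \<Rightarrow> real ^ 'n \<Rightarrow> ennreal" where
  "inner_score \<Lambda> \<rho> V F A k = (\<integral>\<^sup>+ y. ennreal (score_integrand \<Lambda> \<rho> V A k y) \<partial>F)"

definition pointwise_oriented ::
  "(real ^ 'n \<Rightarrow> real) \<Rightarrow> (('w \<Rightarrow> real) \<Rightarrow> real) \<Rightarrow> (real ^ 'n \<Rightarrow> real ^ 'n \<Rightarrow> real) \<Rightarrow> bool" where
  "pointwise_oriented \<Lambda> \<rho> V \<longleftrightarrow>
     (\<forall>k y. (k \<in> R_point \<Lambda> \<rho> y \<longrightarrow> 0 \<le> V k y) \<and> (k \<notin> R_point \<Lambda> \<rho> y \<longrightarrow> V k y \<le> 0))"

text \<open>Where the indicators cancel, \<open>ennreal\<close> truncates the right-hand side to 0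
  by orientation, so the dependence on R(y) disappears.\<close>

lemma ennreal_score_integrand:
  assumes "pointwise_oriented \<Lambda> \<rho> V"
  shows "ennreal (score_integrand \<Lambda> \<rho> V A k y) = (if k \<in> A then ennreal (- V k y) else ennreal (V k y))"
  using assms by (auto simp: pointwise_oriented_def score_integrand_def indicator_def ennreal_neg)

lemma inner_score_eq:
  assumes "pointwise_oriented \<Lambda> \<rho> V"
  shows "inner_score \<Lambda> \<rho> V F A k =
    (if k \<in> A then \<integral>\<^sup>+ y. ennreal (- V k y) \<partial>F else \<integral>\<^sup>+ y. ennreal (V k y) \<partial>F)"
  by (simp add: inner_score_def ennreal_score_integrand[OF assms])

lemma score_eq_nn_integral:
  assumes "pointwise_oriented \<Lambda> \<rho> V"
  shows "score \<Lambda> \<rho> V \<pi> A y = enn2ereal (\<integral>\<^sup>+ k. ennreal (score_integrand \<Lambda> \<rho> V A k y) \<partial>\<pi>)"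
proof -
  have "0 \<le> score_integrand \<Lambda> \<rho> V A k y" for k
    using assms by (auto simp: pointwise_oriented_def score_integrand_def indicator_def)
  then show ?thesis
    by (simp add: score_def ext_integral_nonneg e2ennreal_ereal)
qed

lemma expected_score_eq_inner_score:
  assumes oriented: "pointwise_oriented \<Lambda> \<rho> V"
    and meas: "(\<lambda>(k, y). score_integrand \<Lambda> \<rho> V A k y) \<in> borel_measurable (borel \<Otimes>\<^sub>M borel)"
    and "sigma_finite_measure \<pi>" "sigma_finite_measure F"
    and sets: "sets \<pi> = sets borel" "sets F = sets borel"
  shows "expected_score (score \<Lambda> \<rho> V \<pi>) A F = enn2ereal (\<integral>\<^sup>+ k. inner_score \<Lambda> \<rho> V F A k \<partial>\<pi>)"
    and "inner_score \<Lambda> \<rho> V F A \<in> borel_measurable \<pi>"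
proof -
  interpret pair_sigma_finite \<pi> F
    using assms by (simp add: pair_sigma_finite_def)
  have "sets (\<pi> \<Otimes>\<^sub>M F) = sets (borel \<Otimes>\<^sub>M borel)"
    by (intro sets_pair_measure_cong sets)
  then have m: "(\<lambda>(k, y). ennreal (score_integrand \<Lambda> \<rho> V A k y)) \<in> borel_measurable (\<pi> \<Otimes>\<^sub>M F)"
    using meas by (subst measurable_cong_sets[OF _ refl]) (auto simp: split_def)
  show "inner_score \<Lambda> \<rho> V F A \<in> borel_measurable \<pi>"
    using M2.borel_measurable_nn_integral[OF m] by (simp add: inner_score_def[abs_def])
  have "expected_score (score \<Lambda> \<rho> V \<pi>) A F =
      enn2ereal (\<integral>\<^sup>+ y. \<integral>\<^sup>+ k. ennreal (score_integrand \<Lambda> \<rho> V A k y) \<partial>\<pi> \<partial>F)"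
    by (simp add: expected_score_def ext_integral_nonneg score_eq_nn_integral[OF oriented])
  also have "\<dots> = enn2ereal (\<integral>\<^sup>+ k. inner_score \<Lambda> \<rho> V F A k \<partial>\<pi>)"
    using Fubini'[OF m] by (simp add: inner_score_def)
  finally show "expected_score (score \<Lambda> \<rho> V \<pi>) A F = enn2ereal (\<integral>\<^sup>+ k. inner_score \<Lambda> \<rho> V F A k \<partial>\<pi>)" .
qed

text \<open>Otherwise \<open>g \<le> f\<close> almost everywhere and \<open>U\<close> would be a
  null set. Finiteness of the smaller integral rules out equality at \<infinity>.\<close>

lemma nn_integral_strict_mono_on_open:
  assumes "f \<in> borel_measurable \<pi>" "g \<in> borel_measurable \<pi>" "(\<integral>\<^sup>+ x. f x \<partial>\<pi>) < \<infinity>"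
    and le: "\<And>x. f x \<le> g x"
    and "sets \<pi> = sets borel" "strictly_positive \<pi>"
    and "open U" "U \<noteq> {}" and less: "\<And>x. x \<in> U \<Longrightarrow> f x < g x"
  shows "(\<integral>\<^sup>+ x. f x \<partial>\<pi>) < (\<integral>\<^sup>+ x. g x \<partial>\<pi>)"
proof (rule nn_integral_less)
  show "\<not> (AE x in \<pi>. g x \<le> f x)"
  proof
    assume "AE x in \<pi>. g x \<le> f x"
    then have "AE x in \<pi>. x \<notin> U"
      by eventually_elim (use less in \<open>auto simp: not_le[symmetric]\<close>)
    moreover have U: "U \<in> sets \<pi>"
      using assms by simp
    ultimately have "emeasure \<pi> U = 0"
      using AE_iff_measurable[OF U, of "\<lambda>x. x \<notin> U"] sets.sets_into_space[OF U] by auto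
    then show False
      using assms by (force simp: strictly_positive_def)
  qed
qed (use assms in auto)

theorem proposition3p10:
  fixes M :: "'w measure"
    and \<Y>d :: "('w \<Rightarrow> real ^ 'n) set"
    and \<Y> :: "('w \<Rightarrow> real) set"
    and \<Lambda> :: "real ^ 'n \<Rightarrow> real"
    and \<rho> :: "('w \<Rightarrow> real) \<Rightarrow> real"
    and V :: "real ^ 'n \<Rightarrow> real ^ 'n \<Rightarrow> real"
    and \<pi> :: "(real ^ 'n) measure"
  assumes setting: "systemic_risk M \<Y>d \<Y> \<Lambda> \<rho>"
    and V_measurable: "(\<lambda>(k, y). V k y) \<in> borel_measurable (borel \<Otimes>\<^sub>M borel)"
    and integrand_measurable: "\<And>A. A \<in> upper_sets \<Longrightarrow>
          (\<lambda>(k, y). score_integrand \<Lambda> \<rho> V A k y) \<in> borel_measurable (borel \<Otimes>\<^sub>M borel)"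
    and V_oriented: "\<And>F k. F \<in> laws M \<Y>d \<union> range (return borel) \<Longrightarrow>
          (k \<notin> R_law M \<Y>d \<Lambda> \<rho> F \<longrightarrow> expected_ident V k F \<in> {-\<infinity><..0}) \<and>
          (k \<in> R_law M \<Y>d \<Lambda> \<rho> F \<longrightarrow> expected_ident V k F \<in> {0..<\<infinity>})"
    and R_upper: "\<And>Y. Y \<in> \<Y>d \<Longrightarrow> R \<Lambda> \<rho> Y \<in> upper_sets"
    and \<pi>_borel: "sets \<pi> = sets borel"
    and \<pi>_sigma_finite: "sigma_finite_measure \<pi>"
  shows "order_sensitive upper_sets (laws M \<Y>d) (R_law M \<Y>d \<Lambda> \<rho>) (score \<Lambda> \<rho> V \<pi>) \<and>
    ((\<forall>Y\<in>\<Y>d. R \<Lambda> \<rho> Y \<in> closed_upper_sets \<and> R0 \<Lambda> \<rho> Y = frontier (R \<Lambda> \<rho> Y)) \<and>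
     strict_selective_identification (laws M \<Y>d) (R0_law M \<Y>d \<Lambda> \<rho>) V \<and>
     strictly_positive \<pi> \<longrightarrow>
     (\<forall>A\<in>closed_upper_sets. \<forall>B\<in>closed_upper_sets. \<forall>F\<in>laws M \<Y>d.
        ((A \<subset> B \<and> B \<subseteq> R_law M \<Y>d \<Lambda> \<rho> F) \<or> (R_law M \<Y>d \<Lambda> \<rho> F \<subseteq> B \<and> B \<subset> A)) \<and>
        expected_score (score \<Lambda> \<rho> V \<pi>) B F < \<infinity> \<longrightarrow>
        expected_score (score \<Lambda> \<rho> V \<pi>) B F < expected_score (score \<Lambda> \<rho> V \<pi>) A F))"
proof -
  interpret systemic_risk M \<Y>d \<Y> \<Lambda> \<rho> by (rule setting)
  let ?R = "R_law M \<Y>d \<Lambda> \<rho>" and ?I = "inner_score \<Lambda> \<rho> V" and ?S = "expected_score (score \<Lambda> \<rho> V \<pi>)"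
  have "V k \<in> borel_measurable borel" for k
    using measurable_Pair2[OF V_measurable, of k] by simp
  then have oriented: "pointwise_oriented \<Lambda> \<rho> V"
    using V_oriented[of "return borel _"]
    by (simp add: pointwise_oriented_def expected_ident_return R_law_return)
  have law: "sigma_finite_measure F" "sets F = sets borel" if "F \<in> laws M \<Y>d" for F
  proof -
    obtain Y where "Y \<in> borel_measurable M" "F = distr M borel Y"
      using \<open>F \<in> laws M \<Y>d\<close> \<Y>d_measurable by (auto simp: laws_def)
    then show "sigma_finite_measure F" "sets F = sets borel"
      by (simp_all add: prob_space_distr prob_space_imp_sigma_finite)
  qed
  have score: "?S A F = enn2ereal (\<integral>\<^sup>+ k. ?I F A k \<partial>\<pi>)" "?I F A \<in> borel_measurable \<pi>"
    if "A \<in> upper_sets" "F \<in> laws M \<Y>d" for A F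
    using expected_score_eq_inner_score[OF oriented integrand_measurable[OF that(1)]
        \<pi>_sigma_finite law(1)[OF that(2)] \<pi>_borel law(2)[OF that(2)]] .
  have sign: "k \<in> ?R F \<Longrightarrow> expected_ident V k F \<in> {0..<\<infinity>}"
    "k \<notin> ?R F \<Longrightarrow> expected_ident V k F \<in> {-\<infinity><..0}" if "F \<in> laws M \<Y>d" for F k
    using V_oriented[of F k] that by auto
  \<comment> \<open>Both sides agree off the symmetric difference. In the first case a point of
    \<open>B - A\<close> lies in R(F), in the second a point of \<open>A - B\<close> lies outside
    it, which decides which part of \<open>V k\<close> dominates.\<close>
  have inner_le: "?I F B k \<le> ?I F A k"
    if "F \<in> laws M \<Y>d" "(A \<subseteq> B \<and> B \<subseteq> ?R F) \<or> (?R F \<subseteq> B \<and> B \<subseteq> A)" for A B F k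
    using that expected_ident_nonneg_imp(1)[OF sign(1)] expected_ident_nonpos_imp(1)[OF sign(2)]
    by (auto simp: inner_score_eq[OF oriented]) blast
  have "order_sensitive upper_sets (laws M \<Y>d) ?R (score \<Lambda> \<rho> V \<pi>)"
    unfolding order_sensitive_def
    by (intro ballI impI) (simp add: score less_eq_ennreal.rep_eq[symmetric] nn_integral_mono inner_le)
  moreover have "?S B F < ?S A F"
    if closed: "\<forall>Y\<in>\<Y>d. R \<Lambda> \<rho> Y \<in> closed_upper_sets \<and> R0 \<Lambda> \<rho> Y = frontier (R \<Lambda> \<rho> Y)"
      and ident: "strict_selective_identification (laws M \<Y>d) (R0_law M \<Y>d \<Lambda> \<rho>) V"
      and pos: "strictly_positive \<pi>"
      and AB: "A \<in> closed_upper_sets" "B \<in> closed_upper_sets" and F: "F \<in> laws M \<Y>d"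
      and nested: "(A \<subset> B \<and> B \<subseteq> ?R F) \<or> (?R F \<subseteq> B \<and> B \<subset> A)"
      and fin: "?S B F < \<infinity>" for A B F
  proof -
    have up: "A \<in> upper_sets" "B \<in> upper_sets" "closed A" "closed B"
      using AB by (auto simp: closed_upper_sets_def)
    obtain Y where Y: "Y \<in> \<Y>d" "?R F = R \<Lambda> \<rho> Y" "R0_law M \<Y>d \<Lambda> \<rho> F = R0 \<Lambda> \<rho> Y"
      using law_representative[OF F] .
    then have clR: "closed (?R F)" and fr: "R0_law M \<Y>d \<Lambda> \<rho> F = frontier (?R F)"
      using closed by (auto simp: closed_upper_sets_def)
    have nonzero: "expected_ident V k F \<noteq> 0" if "k \<notin> frontier (?R F)" for k
      using ident F that fr by (auto simp: strict_selective_identification_def)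
    obtain U where U: "open U" "U \<noteq> {}" "\<And>k. k \<in> U \<Longrightarrow> ?I F B k < ?I F A k"
      using nested
    proof
      assume *: "A \<subset> B \<and> B \<subseteq> ?R F"
      then obtain U where U: "open U" "U \<noteq> {}" "U \<subseteq> B - A"
        using open_subset_upper_diff[OF up(3,2)] by blast
      have "?I F B k < ?I F A k" if "k \<in> U" for k
      proof -
        \<comment> \<open>The open set \<open>U\<close> inside R(F) lies in its interior and so
          misses the boundary.\<close>
        have "k \<in> interior (?R F)"
          using U * that by (intro interiorI[of U]) auto
        then have k: "k \<in> ?R F" "k \<notin> frontier (?R F)"
          using interior_subset by (auto simp: frontier_def)
        show ?thesis
          using expected_ident_nonneg_imp(2)[OF sign(1)[OF F k(1)] nonzero[OF k(2)]] U(3) that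
          by (auto simp: inner_score_eq[OF oriented])
      qed
      then show ?thesis
        using that U by blast
    next
      assume *: "?R F \<subseteq> B \<and> B \<subset> A"
      then obtain U where U: "open U" "U \<noteq> {}" "U \<subseteq> A - B"
        using open_subset_upper_diff[OF up(4,1)] by blast
      have "?I F B k < ?I F A k" if "k \<in> U" for k
      proof -
        \<comment> \<open>Outside R(F) it is closedness that keeps \<open>k\<close> off the
          boundary.\<close>
        have k: "k \<notin> ?R F" "k \<notin> frontier (?R F)"
          using U(3) * that clR by (auto dest: frontier_subset_closed)
        show ?thesis
          using expected_ident_nonpos_imp(2)[OF sign(2)[OF F k(1)] nonzero[OF k(2)]] U(3) that
          by (auto simp: inner_score_eq[OF oriented])
      qed
      then show ?thesis
        using that U by blast
    qed
    have "(\<integral>\<^sup>+ k. ?I F B k \<partial>\<pi>) < (\<integral>\<^sup>+ k. ?I F A k \<partial>\<pi>)"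
    proof (rule nn_integral_strict_mono_on_open)
      show "(\<integral>\<^sup>+ k. ?I F B k \<partial>\<pi>) < \<infinity>"
        using fin score(1)[OF up(2) F] by (simp add: less_ennreal.rep_eq)
      show "?I F B k \<le> ?I F A k" for k
        using inner_le[OF F] nested by blast
    qed (use score(2) up F \<pi>_borel pos U in auto)
    then show ?thesis
      using score(1) up F by (simp add: less_ennreal.rep_eq)
  qed
  ultimately show ?thesis
    by blast
qed

end
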